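(* Suppose that the mapping $(\theta,\tilde\theta)\mapsto \nabla Q(\theta\mid\tilde\theta;y)$ is jointly continuous on $\Theta\times\Theta$. If $\theta^*\in\Theta$ is the limit of an EM sequence $\{\theta^{(t)}\}_{t\ge 0}$, then $\nabla l(\theta^*;y)=0$.
   Context: Setting: $(Y,U)$ is a random vector with $Y\in\mathbb{R}^N$ and $U\in\mathbb{R}^q$, having density $f(y,u;\theta)$ with respect to a product measure $\lambda\times\mu$ ($\lambda$ a measure on $\mathbb{R}^N$, $\mu$ a measure on $\mathbb{R}^q$), indexed by $\theta\in\Theta$, where $\Theta$ is an open subset of $\mathbb{R}^d$. Only $Y=y$ is observed, and $y$ is fixed. The likelihood is $L(\theta;y)=\int f(y,u;\theta)\,\mu(du)$ and the log-likelihood is $l(\theta;y)=\log L(\theta;y)$. The conditional density of $U$ given $Y=y$ is $h(u\mid y;\theta)=f(y,u;\theta)/L(\theta;y)$. The $Q$-function is the (real-valued) mapping on $\Theta\times\Theta$ $$Q(\theta\mid\tilde\theta;y)=\mathrm{E}\{\log f(y,U;\theta)\mid y;\tilde\theta\}=\int \log f(y,u;\theta)\,h(u\mid y;\tilde\theta)\,\mu(du).$$ An EM sequence is a sequence $\{\theta^{(t)}:t=0,1,2,\dots\}$ in $\Theta$ such that, for every $t$, $Q(\theta^{(t+1)}\mid\theta^{(t)};y)\ge Q(\theta\mid\theta^{(t)};y)$ for all $\theta\in\Theta$. The symbol $\nabla$ denotes differentiation with respect to the first argument $\theta$; the derivatives written ($\nabla Q(\cdot\mid\tilde\theta;y)$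 and $\nabla l(\cdot;y)$) are understood to exist. *)

theory Defs
  imports "HOL-Probability.Probability"
begin

definition gradient :: "('a::real_inner \<Rightarrow> real) \<Rightarrow> 'a \<Rightarrow> 'a"
  where "gradient g x = (THE D. GDERIV g x :> D)"

lemma gradient_eqI:
  assumes "GDERIV g x :> D"
  shows "gradient g x = D"
  unfolding gradient_def
proof (rule the_equality)
  show "GDERIV g x :> D"
    by (fact assms)
next
  fix D'
  assume "GDERIV g x :> D'"
  with assms have "(\<lambda>h. inner h D') = (\<lambda>h. inner h D)"
    unfolding gderiv_def using has_derivative_unique by blast
  then have "inner (D' - D) D' = inner (D' - D) D"
    by (rule fun_cong)
  then have "inner (D' - D) (D' - D) = 0"
    by (simp add: inner_diff_right)
  then show "D' = D"
    by simp
qed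

text \<open>
  Throughout, \<open>f y u \<theta>\<close> is the joint density of the observed \<open>y\<close> and the latent \<open>u\<close> at parameter
  \<open>\<theta>\<close>, and \<open>\<mu>\<close> is the reference measure for the latent part.
\<close>

definition lik :: "'u measure \<Rightarrow> ('y \<Rightarrow> 'u \<Rightarrow> 't \<Rightarrow> real) \<Rightarrow> 'y \<Rightarrow> 't \<Rightarrow> real"
  where "lik \<mu> f y \<theta> = (\<integral>u. f y u \<theta> \<partial>\<mu>)"

definition loglik :: "'u measure \<Rightarrow> ('y \<Rightarrow> 'u \<Rightarrow> 't \<Rightarrow> real) \<Rightarrow> 'y \<Rightarrow> 't \<Rightarrow> real"
  where "loglik \<mu> f y \<theta> = ln (lik \<mu> f y \<theta>)"

definition cond_dens :: "'u measure \<Rightarrow> ('y \<Rightarrow> 'u \<Rightarrow> 't \<Rightarrow> real) \<Rightarrow> 'y \<Rightarrow> 't \<Rightarrow> 'u \<Rightarrow> real"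
  where "cond_dens \<mu> f y \<theta> u = f y u \<theta> / lik \<mu> f y \<theta>"

text \<open>
  Isabelle has \<open>ln 0 = 0\<close> and gives a non-integrable function the integral \<open>0\<close>, so the following
  real-valued formula is the intended \<open>Q\<close> only where the extended-real integral, taken with
  \<open>log 0 = -\<infinity>\<close> and \<open>(-\<infinity>) * 0 = 0\<close>, is finite. The predicate \<open>Q_finite\<close> expresses exactly this.
\<close>

definition Q_fun :: "'u measure \<Rightarrow> ('y \<Rightarrow> 'u \<Rightarrow> 't \<Rightarrow> real) \<Rightarrow> 'y \<Rightarrow> 't \<Rightarrow> 't \<Rightarrow> real"
  where "Q_fun \<mu> f y \<theta> \<theta>' = (\<integral>u. ln (f y u \<theta>) * cond_dens \<mu> f y \<theta>' u \<partial>\<mu>)"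

definition Q_finite :: "'u measure \<Rightarrow> ('y \<Rightarrow> 'u \<Rightarrow> 't \<Rightarrow> real) \<Rightarrow> 'y \<Rightarrow> 't \<Rightarrow> 't \<Rightarrow> bool"
  where "Q_finite \<mu> f y \<theta> \<theta>' \<longleftrightarrow>
    (AE u in \<mu>. cond_dens \<mu> f y \<theta>' u \<noteq> 0 \<longrightarrow> f y u \<theta> \<noteq> 0) \<and>
    integrable \<mu> (\<lambda>u. ln (f y u \<theta>) * cond_dens \<mu> f y \<theta>' u)"

definition EM_sequence ::
  "'u measure \<Rightarrow> ('y \<Rightarrow> 'u \<Rightarrow> 't \<Rightarrow> real) \<Rightarrow> 'y \<Rightarrow> 't set \<Rightarrow> (nat \<Rightarrow> 't) \<Rightarrow> bool"
  where "EM_sequence \<mu> f y \<Theta> \<theta>s \<longleftrightarrow>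
    (\<forall>t. \<theta>s t \<in> \<Theta>) \<and>
    (\<forall>t. \<forall>\<theta>\<in>\<Theta>. Q_fun \<mu> f y (\<theta>s (Suc t)) (\<theta>s t) \<ge> Q_fun \<mu> f y \<theta> (\<theta>s t))"

end

theory Submission
  imports Defs
begin

text \<open>
  Gibbs' inequality says that \<open>loglik \<theta> - Q(\<theta> | \<theta>')\<close> is minimal over \<open>\<theta>\<close> at \<open>\<theta> = \<theta>'\<close>, so the gradients
  of \<open>loglik\<close> and \<open>Q(\<cdot> | \<theta>')\<close> agree at \<open>\<theta>'\<close>. Every M-step gives \<open>\<nabla>Q(\<theta>\<^bsub>t+1\<^esub> | \<theta>\<^bsub>t\<^esub>) = 0\<close>, and by joint
  continuity this passes to the limit \<open>\<nabla>Q(\<theta>* | \<theta>*) = 0\<close>.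
\<close>

text \<open>Fermat's criterion at an interior maximum: the derivative vanishes as a linear
  functional, and evaluating it at its own representing vector \<open>D\<close> gives
  \<open>inner D D = 0\<close>.\<close>

lemma GDERIV_zero_maximum:
  assumes "GDERIV g x :> D" and "open S" and "x \<in> S" and "\<And>z. z \<in> S \<Longrightarrow> g z \<le> g x"
  shows "D = 0"
proof -
  have "(\<lambda>h. inner h D) = (\<lambda>v. 0)"
    using differential_zero_maxmin[of x S g] assms unfolding gderiv_def by blast
  then have "inner D D = 0"
    by (rule fun_cong)
  then show ?thesis
    by simp
qed

lemma gradient_GDERIV:
  assumes "\<exists>D. GDERIV g x :> D"
  shows "GDERIV g x :> gradient g x"
  using assms gradient_eqI by metis

lemma integral_cond_dens:
  assumes "lik \<mu> f y \<theta> \<noteq> 0"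
  shows "(\<integral>u. cond_dens \<mu> f y \<theta> u \<partial>\<mu>) = 1"
proof -
  have "(\<integral>u. cond_dens \<mu> f y \<theta> u \<partial>\<mu>) = lik \<mu> f y \<theta> / lik \<mu> f y \<theta>"
    unfolding cond_dens_def by (simp flip: lik_def)
  with assms show ?thesis
    by simp
qed

text \<open>Pointwise Gibbs' inequality: this is \<open>ln r \<le> r - 1\<close> at the ratio
  \<open>r\<close> of the conditional densities \<open>a / L\<close> and \<open>b / M\<close>,
  multiplied by \<open>b / M\<close>. The logarithm is split so that the two products on the left
  are the integrands of \<open>Q_fun\<close>, each integrable on its own.\<close>

lemma ln_ratio_times_le:
  fixes a b L M :: real
  assumes "0 \<le> a" "0 \<le> b" "0 < L" "0 < M" and "b \<noteq> 0 \<longrightarrow> a \<noteq> 0"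
  shows "ln a * (b / M) - ln b * (b / M) \<le> a / L - b / M + (ln L - ln M) * (b / M)"
\<comment> \<open>For \<open>b = 0\<close> both products on the left vanish and the right side is
  \<open>a / L\<close>; otherwise the last hypothesis makes the ratio positive.\<close>
proof (cases "b = 0")
  case True
  with assms show ?thesis
    by simp
next
  case False
  with assms have pos: "0 < a" "0 < b"
    by auto
  let ?r = "(a / L) / (b / M)"
  have "ln ?r \<le> ?r - 1"
    using pos assms by (intro ln_le_minus_one) simp
  then have "ln ?r * (b / M) \<le> (?r - 1) * (b / M)"
    using pos assms by (intro mult_right_mono) simp_all
  moreover have "(?r - 1) * (b / M) = a / L - b / M"
    using pos assms by (simp add: field_simps)
  moreover have "ln ?r * (b / M) = ln a * (b / M) - ln b * (b / M) - (ln L - ln M) * (b / M)"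
  proof -
    have "ln ?r = ln a - ln b - (ln L - ln M)"
      using pos assms by (simp add: ln_div ln_mult)
    then show ?thesis
      by (simp only: left_diff_distrib)
  qed
  ultimately show ?thesis
    by linarith
qed

text \<open>Integrating the pointwise bound leaves only the constant: both conditional densities
  have total mass 1, so their difference integrates to 0.\<close>

lemma Q_diff_le_loglik_diff:
  assumes nonneg: "\<And>u. 0 \<le> f y u \<theta>" "\<And>u. 0 \<le> f y u \<theta>'"
    and int: "integrable \<mu> (\<lambda>u. f y u \<theta>)" "integrable \<mu> (\<lambda>u. f y u \<theta>')"
    and pos: "0 < lik \<mu> f y \<theta>" "0 < lik \<mu> f y \<theta>'"
    and fin: "Q_finite \<mu> f y \<theta> \<theta>'" "Q_finite \<mu> f y \<theta>' \<theta>'"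
  shows "Q_fun \<mu> f y \<theta> \<theta>' - Q_fun \<mu> f y \<theta>' \<theta>' \<le> loglik \<mu> f y \<theta> - loglik \<mu> f y \<theta>'"
proof -
  let ?h = "cond_dens \<mu> f y \<theta>" and ?h' = "cond_dens \<mu> f y \<theta>'"
  let ?c = "loglik \<mu> f y \<theta> - loglik \<mu> f y \<theta>'"
  have int_h: "integrable \<mu> ?h" "integrable \<mu> ?h'"
    unfolding cond_dens_def using int by simp_all
  have int_Q: "integrable \<mu> (\<lambda>u. ln (f y u \<theta>) * ?h' u)" "integrable \<mu> (\<lambda>u. ln (f y u \<theta>') * ?h' u)"
    using fin unfolding Q_finite_def by simp_all
  have "AE u in \<mu>. ?h' u \<noteq> 0 \<longrightarrow> f y u \<theta> \<noteq> 0"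
    using fin(1) unfolding Q_finite_def by simp
  then have "AE u in \<mu>. ln (f y u \<theta>) * ?h' u - ln (f y u \<theta>') * ?h' u \<le> ?h u - ?h' u + ?c * ?h' u"
  proof (rule AE_mp, intro AE_I2 impI)
    fix u
    assume "?h' u \<noteq> 0 \<longrightarrow> f y u \<theta> \<noteq> 0"
    \<comment> \<open>Dividing by the positive \<open>lik\<close> does not change where the density
      vanishes.\<close>
    then have "f y u \<theta>' \<noteq> 0 \<longrightarrow> f y u \<theta> \<noteq> 0"
      using pos by (simp add: cond_dens_def)
    then show "ln (f y u \<theta>) * ?h' u - ln (f y u \<theta>') * ?h' u \<le> ?h u - ?h' u + ?c * ?h' u"
      unfolding cond_dens_def loglik_def using nonneg pos by (intro ln_ratio_times_le) simp_all
  qed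
  then have "(\<integral>u. ln (f y u \<theta>) * ?h' u - ln (f y u \<theta>') * ?h' u \<partial>\<mu>)
      \<le> (\<integral>u. ?h u - ?h' u + ?c * ?h' u \<partial>\<mu>)"
    using int_h int_Q by (intro integral_mono_AE) simp_all
  also have "\<dots> = ?c"
    using int_h pos by (simp add: integral_cond_dens)
  finally show ?thesis
    unfolding Q_fun_def using int_Q by simp
qed

theorem theorem2:
  fixes lam :: "(real ^ 'n) measure"
    and \<mu> :: "(real ^ 'q) measure"
    and \<Theta> :: "(real ^ 'd) set"
    and f :: "real ^ 'n \<Rightarrow> real ^ 'q \<Rightarrow> real ^ 'd \<Rightarrow> real"
    and P :: "real ^ 'd \<Rightarrow> 'w measure"
    and Y :: "'w \<Rightarrow> real ^ 'n"
    and U :: "'w \<Rightarrow> real ^ 'q"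
    and y :: "real ^ 'n"
    and \<theta>s :: "nat \<Rightarrow> real ^ 'd"
    and \<theta>_star :: "real ^ 'd"
  assumes "sets lam = sets borel" and "sigma_finite_measure lam"
    and "sets \<mu> = sets borel" and "sigma_finite_measure \<mu>"
    and "open \<Theta>"
    and "\<forall>\<theta>\<in>\<Theta>. prob_space (P \<theta>)"
    and "\<forall>\<theta>\<in>\<Theta>. \<forall>v u. 0 \<le> f v u \<theta>"
    and "\<forall>\<theta>\<in>\<Theta>. distributed (P \<theta>) (lam \<Otimes>\<^sub>M \<mu>) (\<lambda>\<omega>. (Y \<omega>, U \<omega>)) (\<lambda>(v, u). ennreal (f v u \<theta>))"
    and "\<forall>\<theta>\<in>\<Theta>. integrable \<mu> (\<lambda>u. f y u \<theta>) \<and> 0 < lik \<mu> f y \<theta>"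
    and "\<forall>\<theta>\<in>\<Theta>. \<forall>\<theta>'\<in>\<Theta>. Q_finite \<mu> f y \<theta> \<theta>'"
    and "\<forall>\<theta>\<in>\<Theta>. \<forall>\<theta>'\<in>\<Theta>. \<exists>D. GDERIV (\<lambda>\<eta>. Q_fun \<mu> f y \<eta> \<theta>') \<theta> :> D"
    and "\<forall>\<theta>\<in>\<Theta>. \<exists>D. GDERIV (loglik \<mu> f y) \<theta> :> D"
    and "continuous_on (\<Theta> \<times> \<Theta>) (\<lambda>(\<theta>, \<theta>'). gradient (\<lambda>\<eta>. Q_fun \<mu> f y \<eta> \<theta>') \<theta>)"
    and "EM_sequence \<mu> f y \<Theta> \<theta>s"
    and "\<theta>_star \<in> \<Theta>" and "\<theta>s \<longlonglongrightarrow> \<theta>_star"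
  shows "gradient (loglik \<mu> f y) \<theta>_star = 0"
proof -
  \<comment> \<open>The conditioning parameter comes first, so that \<open>Q \<theta>'\<close> is a
    function of the argument being differentiated.\<close>
  define Q where "Q = (\<lambda>\<theta>'. \<lambda>\<eta>. Q_fun \<mu> f y \<eta> \<theta>')"
  have Q_grad: "GDERIV (Q \<theta>') \<theta> :> gradient (Q \<theta>') \<theta>" if "\<theta> \<in> \<Theta>" "\<theta>' \<in> \<Theta>" for \<theta> \<theta>'
    unfolding Q_def using assms(11) that by (intro gradient_GDERIV) blast
  have l_grad: "GDERIV (loglik \<mu> f y) \<theta>_star :> gradient (loglik \<mu> f y) \<theta>_star"
    using assms(12,15) by (intro gradient_GDERIV) blast
  have in_\<Theta>: "\<theta>s t \<in> \<Theta>" for t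
    using assms(14) unfolding EM_sequence_def by blast
  \<comment> \<open>Each new iterate maximizes \<open>Q (\<theta>s t)\<close> over all of the open
    set \<open>\<Theta>\<close>, hence at an interior point.\<close>
  have M_step: "gradient (Q (\<theta>s t)) (\<theta>s (Suc t)) = 0" for t
  proof (rule GDERIV_zero_maximum)
    show "GDERIV (Q (\<theta>s t)) (\<theta>s (Suc t)) :> gradient (Q (\<theta>s t)) (\<theta>s (Suc t))"
      using in_\<Theta> by (intro Q_grad)
    show "Q (\<theta>s t) \<eta> \<le> Q (\<theta>s t) (\<theta>s (Suc t))" if "\<eta> \<in> \<Theta>" for \<eta>
      using assms(14) that unfolding EM_sequence_def Q_def by blast
  qed (use assms(5) in_\<Theta> in auto)
  \<comment> \<open>Both arguments move with \<open>t\<close>, so continuity in one argument alone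
    would not suffice; the pairs approach a diagonal point of
    \<open>\<Theta> \<times> \<Theta>\<close>.\<close>
  have "(\<lambda>t. (\<theta>s (Suc t), \<theta>s t)) \<longlonglongrightarrow> (\<theta>_star, \<theta>_star)"
    using assms(16) by (intro tendsto_Pair LIMSEQ_Suc)
  then have "(\<lambda>t. gradient (Q (\<theta>s t)) (\<theta>s (Suc t))) \<longlonglongrightarrow> gradient (Q \<theta>_star) \<theta>_star"
    using continuous_on_tendsto_compose[OF assms(13)] assms(15) in_\<Theta> by (fastforce simp: Q_def)
  then have stationary: "gradient (Q \<theta>_star) \<theta>_star = 0"
    by (simp add: M_step LIMSEQ_const_iff)
  \<comment> \<open>Gibbs' inequality conditioned on \<open>\<theta>_star\<close>, rearranged, says
    that \<open>Q \<theta>_star\<close> minus the log-likelihood is largest at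
    \<open>\<theta>_star\<close>; this sign lets the maximum criterion apply again.\<close>
  have "gradient (Q \<theta>_star) \<theta>_star - gradient (loglik \<mu> f y) \<theta>_star = 0"
  proof (rule GDERIV_zero_maximum)
    show "GDERIV (\<lambda>\<eta>. Q \<theta>_star \<eta> - loglik \<mu> f y \<eta>) \<theta>_star
        :> gradient (Q \<theta>_star) \<theta>_star - gradient (loglik \<mu> f y) \<theta>_star"
      using assms(15) by (intro GDERIV_diff Q_grad l_grad)
    show "Q \<theta>_star \<eta> - loglik \<mu> f y \<eta> \<le> Q \<theta>_star \<theta>_star - loglik \<mu> f y \<theta>_star" if "\<eta> \<in> \<Theta>" for \<eta>
      using Q_diff_le_loglik_diff[of f y \<eta> \<theta>_star \<mu>] assms(7,9,10,15) that
      by (simp add: Q_def)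
  qed (use assms(5,15) in auto)
  with stationary show ?thesis
    by simp
qed

end
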